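(* Let $L=0$, $k\in[0,1)$ and $c=\frac{1+k^2-\sqrt{k^4-k^3+3k^2+k}}{1-k^2}\in[0,1]$. The mechanism TwoExtremeRestrict, which maps every location profile $\mathbf x$ to the edge $(a,b)$ with $a=\min(x_r,\,o-oc)$ and $b=\max(y_l,\,o+c-oc)$, is group strategyproof, and its approximation ratio for the maximum cost is at most $$2\cdot\max\left(\frac{1-(1-k)c}{1+k-(1-k)c},\ \frac{k(2c-c^2)+1-c^2}{2-2c+2ck},\ \frac{1+2ck}{2-(1-k)c},\ c\right).$$ (At $k=0$, where $c=1$ and the first two quotients have the form $0/0$, they are read as their limits as $k\to0^+$.)
   Context: Setting ($L=0$). Fix a constant $k\in[0,1)$ and a point obstacle $o\in(0,1)$. Agents $N=\{1,\ldots,n\}$ have locations $x_i\in[0,o)\cup(o,1]$; $N_1=\{i: x_i<o\}$ and $N_2=\{i: x_i>o\}$, both nonempty. An edge is a pair $(a,b)$ with $a\in[0,o)$, $b\in(o,1]$. The cost of agent $i\in N_1$ is $cost(a,b,x_i)=|x_i-a|+k(b-a)+(1-b)$; the cost of agent $i\in N_2$ is $cost(a,b,x_i)=|x_i-b|+k(b-a)+a$. The maximum cost is $MC(a,b,\mathbf x)=\max_{i\in N}cost(a,b,x_i)$. Write $x_r=\max\{x_i: i\in N_1\}$ and $y_l=\min\{x_j: j\in N_2\}$. A mechanism $f$ maps location profiles to edges (the obstacle is known). It is group strategyproof if for every nonempty $S\subseteq N$, every profile $\mathbf x$ and every joint misreport $\mathbf x_S'$ of the agents in $S$ (each agent reporting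 a location in its own region), there is $i\in S$ with $cost(f(\mathbf x),x_i)\le cost(f(\mathbf x_S',\mathbf x_{-S}),x_i)$. Its approximation ratio is at most $\alpha$ if $MC(f(\mathbf x),\mathbf x)\le\alpha\cdot\min_{(a,b)}MC(a,b,\mathbf x)$ (minimum over all edges) for all $o$ and all profiles $\mathbf x$. *)

theory Defs
  imports "HOL-Analysis.Analysis"
begin

text \<open>
  The obstacle is written \<open>ob\<close>. A location profile of the agents \<open>{1..n}\<close> is a function
  \<open>x :: nat \<Rightarrow> real\<close> of which only the values on \<open>{1..n}\<close> matter.
\<close>

type_synonym edge = "real \<times> real"

definition edges :: "real \<Rightarrow> edge set" where
  "edges ob = {0..<ob} \<times> {ob<..1}"

definition left_agents :: "real \<Rightarrow> nat \<Rightarrow> (nat \<Rightarrow> real) \<Rightarrow> nat set" where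
  "left_agents ob n x = {i \<in> {1..n}. x i < ob}"

definition right_agents :: "real \<Rightarrow> nat \<Rightarrow> (nat \<Rightarrow> real) \<Rightarrow> nat set" where
  "right_agents ob n x = {i \<in> {1..n}. x i > ob}"

definition profile :: "real \<Rightarrow> nat \<Rightarrow> (nat \<Rightarrow> real) \<Rightarrow> bool" where
  "profile ob n x \<longleftrightarrow>
     (\<forall>i\<in>{1..n}. x i \<in> {0..<ob} \<union> {ob<..1}) \<and>
     left_agents ob n x \<noteq> {} \<and> right_agents ob n x \<noteq> {}"

definition cost :: "real \<Rightarrow> real \<Rightarrow> edge \<Rightarrow> real \<Rightarrow> real" where
  "cost k ob e z =
     (case e of (a, b) \<Rightarrow>
        if z < ob then \<bar>z - a\<bar> + k * (b - a) + (1 - b)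
        else \<bar>z - b\<bar> + k * (b - a) + a)"

definition max_cost :: "real \<Rightarrow> real \<Rightarrow> nat \<Rightarrow> edge \<Rightarrow> (nat \<Rightarrow> real) \<Rightarrow> real" where
  "max_cost k ob n e x = Max ((\<lambda>i. cost k ob e (x i)) ` {1..n})"

text \<open>
  The edge set is not compact, but for \<open>k \<in> [0,1)\<close> the infimum below is a minimum:
  replacing \<open>(a, b)\<close> by \<open>(min a x\<^sub>r, max b y\<^sub>l)\<close> does not increase any agent's cost, so one may
  restrict to the compact set \<open>[0, x\<^sub>r] \<times> [y\<^sub>l, 1]\<close>.
\<close>

definition opt_max_cost :: "real \<Rightarrow> real \<Rightarrow> nat \<Rightarrow> (nat \<Rightarrow> real) \<Rightarrow> real" where
  "opt_max_cost k ob n x = (INF e\<in>edges ob. max_cost k ob n e x)"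

type_synonym rule = "real \<Rightarrow> nat \<Rightarrow> (nat \<Rightarrow> real) \<Rightarrow> edge"

definition mechanism :: "rule \<Rightarrow> bool" where
  "mechanism f \<longleftrightarrow>
     (\<forall>ob n x. 0 < ob \<and> ob < 1 \<and> profile ob n x \<longrightarrow> f ob n x \<in> edges ob)"

text \<open>
  A misreport keeps each agent of the coalition in its own region;
  \<open>override_on x x' S\<close> is the profile \<open>(x'\<^sub>S, x\<^sub>-\<^sub>S)\<close>.
\<close>

definition misreport ::
  "real \<Rightarrow> nat set \<Rightarrow> (nat \<Rightarrow> real) \<Rightarrow> (nat \<Rightarrow> real) \<Rightarrow> bool" where
  "misreport ob S x x' \<longleftrightarrow>
     (\<forall>i\<in>S. (x i < ob \<longrightarrow> x' i \<in> {0..<ob}) \<and> (x i > ob \<longrightarrow> x' i \<in> {ob<..1}))"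

definition group_strategyproof :: "real \<Rightarrow> rule \<Rightarrow> bool" where
  "group_strategyproof k f \<longleftrightarrow>
     (\<forall>ob n x S x'.
        0 < ob \<and> ob < 1 \<and> profile ob n x \<and> S \<subseteq> {1..n} \<and> S \<noteq> {} \<and> misreport ob S x x' \<longrightarrow>
        (\<exists>i\<in>S. cost k ob (f ob n x) (x i) \<le> cost k ob (f ob n (override_on x x' S)) (x i)))"

definition approx_ratio_le :: "real \<Rightarrow> rule \<Rightarrow> real \<Rightarrow> bool" where
  "approx_ratio_le k f \<alpha> \<longleftrightarrow>
     (\<forall>ob n x. 0 < ob \<and> ob < 1 \<and> profile ob n x \<longrightarrow>
        max_cost k ob n (f ob n x) x \<le> \<alpha> * opt_max_cost k ob n x)"

definition two_extreme_restrict :: "real \<Rightarrow> rule" where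
  "two_extreme_restrict c ob n x =
     (min (Max (x ` left_agents ob n x)) (ob - ob * c),
      max (Min (x ` right_agents ob n x)) (ob + c - ob * c))"

definition c_param :: "real \<Rightarrow> real" where
  "c_param k = (1 + k^2 - sqrt (k^4 - k^3 + 3 * k^2 + k)) / (1 - k^2)"

text \<open>
  Since \<open>c_param 0 = 1\<close>, the first two quotients in \<open>ratio_bound\<close> are \<open>0 / 0\<close> at \<open>k = 0\<close>;
  there they are read as their limits for \<open>k\<close> tending to \<open>0\<close> from above.
\<close>

definition limit_at_zero :: "(real \<Rightarrow> real) \<Rightarrow> real \<Rightarrow> real" where
  "limit_at_zero q k = (if k = 0 then Lim (at_right 0) q else q k)"

definition quotient1 :: "real \<Rightarrow> real" where
  "quotient1 k = (let c = c_param k in (1 - (1 - k) * c) / (1 + k - (1 - k) * c))"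

definition quotient2 :: "real \<Rightarrow> real" where
  "quotient2 k =
     (let c = c_param k in (k * (2 * c - c^2) + 1 - c^2) / (2 - 2 * c + 2 * c * k))"

definition quotient3 :: "real \<Rightarrow> real" where
  "quotient3 k = (let c = c_param k in (1 + 2 * c * k) / (2 - (1 - k) * c))"

definition ratio_bound :: "real \<Rightarrow> real" where
  "ratio_bound k =
     2 * Max {limit_at_zero quotient1 k, limit_at_zero quotient2 k, quotient3 k, c_param k}"

end

(*
  Against an edge (a', b') the agents at x_r and y_l, averaged with weights w and 1 - w for
  (1 - k) / 2 <= w <= (1 + k) / 2, force the maximum cost up to
  k (y_l - x_r) + w (1 - y_l) + (1 - w) x_r, since for these weights moving a' away from x_r or
  b' away from y_l does not help. Adding a third agent p to the left of x_r, with weights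
  (1 - k) / 2, k, (1 - k) / 2 on x_r, p, y_l, gives the bound that handles the agents to the left
  of the chosen a: it yields the first quotient. The agents between a and the obstacle are handled
  by the two extreme values of w; after moving x_r to the obstacle the estimate is piecewise
  linear, and its vertices yield the remaining terms. Of c only 0 <= c <= 1 / (1 + k) is needed.
  For group strategyproofness: an improvement of a for the right agents hurts the agent at x_r by
  a factor 1 + k, whereas the gain is only 1 - k, so a' < a would require a larger increase of b,
  which in turn requires a larger decrease of a.
*)
theory Submission
  imports Defs
begin

section \<open>Lower bounds on the maximum cost of an arbitrary edge\<close>

lemma mult_le_mult_abs:
  fixes w \<alpha> t :: real
  assumes "- \<alpha> \<le> w" "w \<le> \<alpha>"
  shows "w * t \<le> \<alpha> * \<bar>t\<bar>"
proof (cases "t \<ge> 0")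
  case True
  then show ?thesis using assms by (simp add: mult_right_mono)
next
  case False
  then show ?thesis using mult_right_mono_neg[of "- \<alpha>" w t] assms by simp
qed

text \<open>Apart from the distance terms, the average of the two costs has slope
  \<open>1 - \<alpha> - k\<close> in \<open>a\<close> and \<open>k - \<alpha>\<close> in
  \<open>b\<close>. The window for \<open>\<alpha>\<close> says exactly that these slopes are at
  most \<open>\<alpha>\<close> and \<open>1 - \<alpha>\<close> in absolute value, so the distances
  pay for replacing \<open>a\<close> by \<open>A\<close> and \<open>b\<close> by
  \<open>y\<close>.\<close>

lemma two_agent_lower_bound:
  fixes A y a b z \<alpha> k :: real
  assumes k: "0 \<le> k" "k < 1" and \<alpha>: "(1 - k) / 2 \<le> \<alpha>" "\<alpha> \<le> (1 + k) / 2"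
    and A: "\<bar>A - a\<bar> + k * (b - a) + (1 - b) \<le> z"
    and y: "\<bar>y - b\<bar> + k * (b - a) + a \<le> z"
  shows "k * (y - A) + \<alpha> * (1 - y) + (1 - \<alpha>) * A \<le> z"
proof -
  have weights: "0 \<le> \<alpha>" "0 \<le> 1 - \<alpha>" using k \<alpha> by (simp_all add: field_simps)
  have "\<alpha> * (\<bar>A - a\<bar> + k * (b - a) + (1 - b)) \<le> \<alpha> * z"
    by (rule mult_left_mono[OF A weights(1)])
  moreover have "(1 - \<alpha>) * (\<bar>y - b\<bar> + k * (b - a) + a) \<le> (1 - \<alpha>) * z"
    by (rule mult_left_mono[OF y weights(2)])
  moreover have "(1 - \<alpha> - k) * (A - a) \<le> \<alpha> * \<bar>A - a\<bar>"
    by (rule mult_le_mult_abs) (use k \<alpha> in \<open>auto simp: field_simps\<close>)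
  moreover have "(k - \<alpha>) * (y - b) \<le> (1 - \<alpha>) * \<bar>y - b\<bar>"
    by (rule mult_le_mult_abs) (use k \<alpha> in \<open>auto simp: field_simps\<close>)
  ultimately show ?thesis by (simp add: algebra_simps)
qed

text \<open>The distances are bounded below by \<open>A - a\<close>, \<open>a - p\<close> and
  \<open>b - y\<close>; with weights \<open>(1 - k) / 2\<close>, \<open>k\<close>,
  \<open>(1 - k) / 2\<close> the variables \<open>a\<close> and \<open>b\<close> then
  cancel.\<close>

lemma three_agent_lower_bound:
  fixes A p y a b z k :: real
  assumes k: "0 \<le> k" "k < 1"
    and A: "\<bar>A - a\<bar> + k * (b - a) + (1 - b) \<le> z"
    and p: "\<bar>p - a\<bar> + k * (b - a) + (1 - b) \<le> z"
    and y: "\<bar>y - b\<bar> + k * (b - a) + a \<le> z"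
  shows "k * (y - p) + (1 + k) / 2 * (1 - y) + (1 - k) / 2 * A \<le> z"
proof -
  have "(1 - k) * (A - a + k * (b - a) + (1 - b)) \<le> (1 - k) * z"
    by (rule mult_left_mono) (use A k in linarith)+
  moreover have "k * (a - p + k * (b - a) + (1 - b)) \<le> k * z"
    by (rule mult_left_mono) (use p k in linarith)+
  moreover have "(1 - k) * (b - y + k * (b - a) + a) \<le> (1 - k) * z"
    by (rule mult_left_mono) (use y k in linarith)+
  ultimately show ?thesis by (simp add: field_simps)
qed

section \<open>The approximation ratio as a real inequality\<close>

lemma affine_nonneg_between:
  fixes P Q u v t :: real
  assumes "0 \<le> P + Q * u" "0 \<le> P + Q * v" "u \<le> t" "t \<le> v"
  shows "0 \<le> P + Q * t"
proof (cases "Q \<ge> 0")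
  case True
  then show ?thesis using mult_left_mono[of u t Q] assms by linarith
next
  case False
  then show ?thesis using mult_left_mono_neg[of t v Q] assms by linarith
qed

text \<open>\<open>R\<close> is the ratio to be proved. \<open>R_q1\<close> to \<open>R_c\<close>
  are the four terms of the bound cleared of denominators, which keeps them meaningful at
  \<open>k = 0\<close>; \<open>R_q3\<close> has 2 in place of the denominator
  \<open>2 - (1 - k) * c\<close>. The cap \<open>R2\<close> allows agents to be moved to extreme
  positions.\<close>

locale ratio_constants =
  fixes k c R :: real
  assumes k0: "0 \<le> k" and k1: "k < 1" and c0: "0 \<le> c" and c1: "c * (1 + k) \<le> 1"
    and R2: "R \<le> 2"
    and R_q1: "2 * (1 - (1 - k) * c) \<le> R * (1 + k - (1 - k) * c)"
    and R_q2: "k * (2 * c - c\<^sup>2) + 1 - c\<^sup>2 \<le> R * (1 - (1 - k) * c)"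
    and R_q3: "1 + 2 * k * c \<le> R"
    and R_c: "2 * c \<le> R"
begin

lemma c_le_1: "c \<le> 1"
  using c1 mult_nonneg_nonneg[OF c0 k0] by (simp add: distrib_left)

lemma R_pos: "0 < R"
  using R_q3 mult_nonneg_nonneg[OF k0 c0] by simp

text \<open>The left side is \<open>M - p\<close>, while \<open>z\<close> is at least
  \<open>(M + k) / 2 - k * p\<close>. The worst case is \<open>p = 0\<close>, since
  \<open>r * k \<le> 1\<close>, with the smallest gap \<open>b - a = c\<close>, since
  \<open>M / (M + k)\<close> does not decrease in \<open>M\<close>; there the claim is
  \<open>R_q1\<close>.\<close>

lemma far_agent_bound:
  assumes p: "0 \<le> p" and ab: "c \<le> b - a" "b - a \<le> 1" "0 \<le> a" "b \<le> 1"
    and aA: "a \<le> A" and yb: "y \<le> b"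
    and z: "k * (y - p) + (1 + k) / 2 * (1 - y) + (1 - k) / 2 * A \<le> z" "0 \<le> z"
  shows "a - p + k * (b - a) + (1 - b) \<le> R * z"
proof -
  define m where "m = 1 - (1 - k) * c"
  define M where "M = 1 - (1 - k) * (b - a)"
  have Mm: "M \<le> m" unfolding M_def m_def using ab k1 by (simp add: mult_left_mono)
  have "(1 - k) * (b - a) \<le> (1 - k) * 1" by (rule mult_left_mono) (use ab k1 in simp_all)
  then have kM: "k \<le> M" unfolding M_def by (simp add: algebra_simps)
  have M1: "M \<le> 1" unfolding M_def using ab c0 k1 by simp
  have "(1 - k) * a \<le> (1 - k) * A" using aA k1 by simp
  moreover have "(1 - k) * y \<le> (1 - k) * b" using yb k1 by simp
  ultimately have zB: "(M + k) / 2 - k * p \<le> z"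
    using z unfolding M_def by (simp add: field_simps)
  have goal_eq: "a - p + k * (b - a) + (1 - b) = M - p" unfolding M_def by (simp add: algebra_simps)
  show ?thesis
  \<comment> \<open>\<open>M = 0\<close> forces \<open>k = 0\<close>, where \<open>r\<close> below
    would be 0 / 0; the left side is then \<open>- p\<close>.\<close>
  proof (cases "M = 0")
    case True
    moreover have "0 \<le> R * z" using R_pos z by simp
    ultimately show ?thesis unfolding goal_eq using p by linarith
  next
    case False
    then have M0: "0 < M" using kM k0 by simp
    define r where "r = 2 * M / (M + k)"
    have r: "r * (M + k) = 2 * M" unfolding r_def using M0 k0 by simp
    have r0: "0 \<le> r" unfolding r_def using M0 k0 by simp
    have "2 * M * (m + k) \<le> 2 * m * (M + k)"
      using mult_right_mono[OF Mm k0] by (simp add: algebra_simps)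
    also have "\<dots> \<le> R * (m + k) * (M + k)"
      using R_q1 M0 k0 unfolding m_def by (intro mult_right_mono) (auto simp: algebra_simps)
    finally have "(m + k) * (r * (M + k)) \<le> (m + k) * (R * (M + k))"
      unfolding r by (simp add: algebra_simps)
    then have "r \<le> R" using M0 Mm k0 by simp
    have "2 * M * k \<le> M + k"
    proof -
      have "0 \<le> (1 - M) * k" "0 \<le> M * (1 - k)" using M1 M0 k0 k1 by auto
      then show ?thesis by (simp add: algebra_simps)
    qed
    then have "r * k \<le> 1" unfolding r_def using M0 k0 by (simp add: field_simps)
    then have "r * k * p \<le> p" using p mult_right_mono[of "r * k" 1 p] by simp
    then have "M - p \<le> r * ((M + k) / 2 - k * p)" using r by (simp add: algebra_simps)
    also have "\<dots> \<le> r * z" using zB r0 by (rule mult_left_mono)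
    also have "\<dots> \<le> R * z" using \<open>r \<le> R\<close> z by (simp add: mult_right_mono)
    finally show ?thesis unfolding goal_eq .
  qed
qed

text \<open>
  The worst case has \<open>x\<^sub>r\<close> at the obstacle. The two lower bounds \<open>L1\<close>, \<open>L2\<close> on the optimum
  coincide at \<open>y = 1 - ob\<close>, and all quantities are affine in \<open>y\<close> and in \<open>ob\<close>, so only the
  vertices \<open>ob = 0\<close> (first quotient), \<open>ob = (1 - c) / (2 - c)\<close> (second quotient),
  \<open>ob = 1 / 2\<close> (third quotient) and \<open>ob = 1\<close> (the term \<open>c\<close>) have to be inspected.
\<close>

lemma obstacle_agent_bound_extreme:
  assumes ob: "0 < ob" "ob < 1" and y: "ob \<le> y" "y \<le> ob + c - ob * c"
    and L1: "k * (y - ob) + (1 - k) / 2 * (1 - y) + (1 + k) / 2 * ob \<le> z"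
    and L2: "k * (y - ob) + (1 + k) / 2 * (1 - y) + (1 - k) / 2 * ob \<le> z"
  shows "ob * c + k * c + (1 - ob) * (1 - c) \<le> R * z"
proof -
  \<comment> \<open>\<open>s\<close> is the obstacle for which the largest admissible
    \<open>y\<close>, called \<open>b0\<close> below, equals \<open>1 - ob\<close>. \<open>T\<close>
    is the cost of an agent at the obstacle under the edge \<open>(ob - ob * c, b0)\<close>.\<close>
  define s where "s = (1 - c) / (2 - c)"
  define T where "T = ob * c + k * c + (1 - ob) * (1 - c)"
  have c2: "0 < 2 - c" using c_le_1 by simp
  have split: "P + Q * s \<ge> 0" if "P * (2 - c) + Q * (1 - c) \<ge> 0" for P Q :: real
  proof -
    have "P + Q * s = (P * (2 - c) + Q * (1 - c)) / (2 - c)"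
      unfolding s_def using c2 by (simp add: field_simps)
    then show ?thesis using that c2 by simp
  qed
  define L1_at where "L1_at t = k * (t - ob) + (1 - k) / 2 * (1 - t) + (1 + k) / 2 * ob" for t
  define L2_at where "L2_at t = k * (t - ob) + (1 + k) / 2 * (1 - t) + (1 - k) / 2 * ob" for t
  define b0 where "b0 = ob + c - ob * c"
  have R_c': "(k + 1) * c \<le> R * ((1 + k) / 2)"
    using mult_right_mono[OF R_c, of "(1 + k) / 2"] k0 by (simp add: field_simps)
  have ob_s: "ob \<le> s \<longleftrightarrow> b0 \<le> 1 - ob"
    unfolding s_def b0_def using c2 by (simp add: pos_le_divide_eq algebra_simps)
  \<comment> \<open>In each of the next four facts \<open>P + Q * ob\<close> is \<open>R\<close>
    times a lower bound minus \<open>T\<close>, with \<open>y\<close> set to \<open>b0\<close>,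
    \<open>1 - ob\<close> or \<open>ob\<close>. This is affine in \<open>ob\<close>, so the ends of
    the range of \<open>ob\<close> suffice.\<close>
  have below_s: "T \<le> R * L2_at b0" if "ob \<le> s"
  proof -
    define P where "P = R * (k * c + (1 + k) / 2 * (1 - c)) - (k * c + 1 - c)"
    define Q where "Q = R * ((1 - k) / 2 - k * c - (1 + k) / 2 * (1 - c)) - (2 * c - 1)"
    have "0 \<le> P + Q * 0" unfolding P_def using R_q1 by (simp add: field_simps)
    moreover have "0 \<le> P + Q * s"
      by (rule split) (use R_q2 in \<open>simp add: P_def Q_def field_simps power2_eq_square\<close>)
    ultimately have "0 \<le> P + Q * ob" by (rule affine_nonneg_between) (use ob that in auto)
    also have "P + Q * ob = R * L2_at b0 - T"
      unfolding P_def Q_def L2_at_def T_def b0_def by (simp add: field_simps)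
    finally show ?thesis by simp
  qed
  have above_s: "T \<le> R * L1_at b0" if "s \<le> ob"
  proof -
    define P where "P = R * (k * c + (1 - k) / 2 * (1 - c)) - (k * c + 1 - c)"
    define Q where "Q = R * ((1 + k) / 2 - k * c - (1 - k) / 2 * (1 - c)) - (2 * c - 1)"
    have "0 \<le> P + Q * s"
      by (rule split) (use R_q2 in \<open>simp add: P_def Q_def field_simps power2_eq_square\<close>)
    moreover have "0 \<le> P + Q * 1" unfolding P_def Q_def using R_c' by (simp add: field_simps)
    ultimately have "0 \<le> P + Q * ob" by (rule affine_nonneg_between) (use ob that in auto)
    also have "P + Q * ob = R * L1_at b0 - T"
      unfolding P_def Q_def L1_at_def T_def b0_def by (simp add: field_simps)
    finally show ?thesis by simp
  qed
  have middle: "T \<le> R * (k * (1 - 2 * ob) + ob)" if "s \<le> ob" "ob \<le> 1 / 2"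
  proof -
    define P where "P = R * k - (k * c + 1 - c)"
    define Q where "Q = R * (1 - 2 * k) - (2 * c - 1)"
    have "0 \<le> P + Q * s"
      by (rule split) (use R_q2 in \<open>simp add: P_def Q_def field_simps power2_eq_square\<close>)
    moreover have "0 \<le> P + Q * (1 / 2)" unfolding P_def Q_def using R_q3 by (simp add: field_simps)
    ultimately have "0 \<le> P + Q * ob" by (rule affine_nonneg_between) (use that in auto)
    also have "P + Q * ob = R * (k * (1 - 2 * ob) + ob) - T"
      unfolding P_def Q_def T_def by (simp add: field_simps)
    finally show ?thesis by simp
  qed
  have upper_half: "T \<le> R * L1_at ob" if "1 / 2 \<le> ob"
  proof -
    define P where "P = R * ((1 - k) / 2) - (k * c + 1 - c)"
    define Q where "Q = R * k - (2 * c - 1)"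
    have "0 \<le> P + Q * (1 / 2)" unfolding P_def Q_def using R_q3 by (simp add: field_simps)
    moreover have "0 \<le> P + Q * 1" unfolding P_def Q_def using R_c' by (simp add: field_simps)
    ultimately have "0 \<le> P + Q * ob" by (rule affine_nonneg_between) (use ob that in auto)
    also have "P + Q * ob = R * L1_at ob - T"
      unfolding P_def Q_def L1_at_def T_def by (simp add: field_simps)
    finally show ?thesis by simp
  qed
  \<comment> \<open>\<open>L2_at\<close> is decreasing, so its worst \<open>y\<close> is the largest
    one. The slope of \<open>L1_at\<close> changes sign at \<open>k = 1 / 3\<close>, so
    \<open>L1_between\<close> asks for both ends.\<close>
  have L2_antimono: "L2_at v \<le> L2_at u" if "u \<le> v" for u v
    using mult_left_mono[OF that, of "1 - k"] k1 unfolding L2_at_def by (simp add: field_simps)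
  have L1_between: "T \<le> R * L1_at y" if "T \<le> R * L1_at u" "T \<le> R * L1_at b0" "u \<le> y" for u
  proof -
    define P where "P = R * ((1 - k) / 2 + (1 + k) / 2 * ob - k * ob) - T"
    define Q where "Q = R * (k - (1 - k) / 2)"
    have eq: "P + Q * t = R * L1_at t - T" for t
      unfolding P_def Q_def L1_at_def by (simp add: field_simps)
    have "0 \<le> P + Q * y"
      by (rule affine_nonneg_between[of _ _ u b0]) (use that y in \<open>auto simp: eq b0_def\<close>)
    then show ?thesis by (simp add: eq)
  qed
  have mid_eq: "L1_at (1 - ob) = k * (1 - 2 * ob) + ob" "L2_at (1 - ob) = k * (1 - 2 * ob) + ob"
    unfolding L1_at_def L2_at_def by (simp_all add: field_simps)
  \<comment> \<open>\<open>L1_at y - L2_at y = k * (y + ob - 1)\<close>, so the stronger bound is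
    \<open>L2_at\<close> up to \<open>1 - ob\<close> and \<open>L1_at\<close> beyond.\<close>
  have "T \<le> R * L1_at y \<or> T \<le> R * L2_at y"
  proof (cases "y \<le> 1 - ob")
    case True
    then have half: "ob \<le> 1 / 2" using y by simp
    show ?thesis
    proof (cases "ob \<le> s")
      case True
      have "R * L2_at b0 \<le> R * L2_at y"
        using L2_antimono[of y b0] R_pos y unfolding b0_def by simp
      then show ?thesis using below_s[OF True] by linarith
    next
      case False
      have "R * L2_at (1 - ob) \<le> R * L2_at y"
        using L2_antimono[OF True] R_pos by simp
      then show ?thesis using middle half False unfolding mid_eq by linarith
    qed
  next
    case False
    then have above: "s \<le> ob" using ob_s y unfolding b0_def by linarith
    show ?thesis
    proof (cases "ob \<le> 1 / 2")
      case True
      then show ?thesis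
        using L1_between[of "1 - ob"] middle above_s above False unfolding mid_eq by simp
    next
      case half: False
      then show ?thesis using L1_between[of ob] upper_half above_s above y by simp
    qed
  qed
  moreover have "R * L1_at y \<le> R * z" "R * L2_at y \<le> R * z"
    using L1 L2 R_pos unfolding L1_at_def L2_at_def by simp_all
  ultimately show ?thesis unfolding T_def by linarith
qed

text \<open>Moving \<open>A\<close> up to \<open>ob\<close> and \<open>y\<close> down to at most
  \<open>b0\<close> reduces the claim to the extreme case. The move raises the cost by at least
  \<open>1 - k\<close> times the total shift and the lower bounds by at most half of that, which
  \<open>R \<le> 2\<close> compensates.\<close>

lemma obstacle_agent_bound:
  assumes ob: "0 < ob" "ob < 1" and A: "A \<le> ob" and y: "ob \<le> y"
    and ab: "a = ob - ob * c" "b = max y (ob + c - ob * c)"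
    and L1: "k * (y - A) + (1 - k) / 2 * (1 - y) + (1 + k) / 2 * A \<le> z"
    and L2: "k * (y - A) + (1 + k) / 2 * (1 - y) + (1 - k) / 2 * A \<le> z"
  shows "A - a + k * (b - a) + (1 - b) \<le> R * z"
proof -
  define b0 where "b0 = ob + c - ob * c"
  define y' where "y' = min y b0"
  define z' where "z' = z + (1 - k) / 2 * ((ob - A) + (y - y'))"
  have nonneg: "0 \<le> ob - A" "0 \<le> y - y'" using A unfolding y'_def by auto
  have b: "b = b0 + (y - y')" unfolding ab y'_def b0_def by auto
  have "0 \<le> c * (1 - ob)" using c0 ob by simp
  then have y'_bounds: "ob \<le> y'" "y' \<le> b0"
    using y unfolding y'_def b0_def by (auto simp: algebra_simps)
  have L1': "k * (y' - ob) + (1 - k) / 2 * (1 - y') + (1 + k) / 2 * ob \<le> z'"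
  proof -
    have "k * (y' - ob) + (1 - k) / 2 * (1 - y') + (1 + k) / 2 * ob + k * (y - y')
        = k * (y - A) + (1 - k) / 2 * (1 - y) + (1 + k) / 2 * A
          + (1 - k) / 2 * ((ob - A) + (y - y'))"
      by (simp add: field_simps)
    moreover have "0 \<le> k * (y - y')" using nonneg k0 by simp
    ultimately show ?thesis using L1 unfolding z'_def by linarith
  qed
  have L2': "k * (y' - ob) + (1 + k) / 2 * (1 - y') + (1 - k) / 2 * ob \<le> z'"
  proof -
    have "k * (y' - ob) + (1 + k) / 2 * (1 - y') + (1 - k) / 2 * ob + k * (ob - A)
        = k * (y - A) + (1 + k) / 2 * (1 - y) + (1 - k) / 2 * A
          + (1 - k) / 2 * ((ob - A) + (y - y'))"
      by (simp add: field_simps)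
    moreover have "0 \<le> k * (ob - A)" using nonneg k0 by simp
    ultimately show ?thesis using L2 unfolding z'_def by linarith
  qed
  have "ob * c + k * c + (1 - ob) * (1 - c) \<le> R * z'"
    by (rule obstacle_agent_bound_extreme[OF ob _ _ L1' L2']) (use y'_bounds b0_def in auto)
  also have "R * z' \<le> R * z + (1 - k) * ((ob - A) + (y - y'))"
    using mult_right_mono[OF R2, of "(1 - k) / 2 * ((ob - A) + (y - y'))"] nonneg k1
    unfolding z'_def by (simp add: distrib_left)
  finally have "ob * c + k * c + (1 - ob) * (1 - c) - (1 - k) * ((ob - A) + (y - y')) \<le> R * z"
    by simp
  moreover have "A - a + k * (b - a) + (1 - b) + k * (ob - A)
      = ob * c + k * c + (1 - ob) * (1 - c) - (1 - k) * ((ob - A) + (y - y'))"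
    unfolding b ab(1) b0_def by (simp add: algebra_simps)
  moreover have "0 \<le> k * (ob - A)" using nonneg k0 by simp
  ultimately show ?thesis by linarith
qed

text \<open>For \<open>p \<le> a\<close> the three-agent bound applies. If \<open>a < p\<close>,
  then \<open>a < A\<close>, so the cap \<open>ob - ob * c\<close> determines \<open>a\<close>, and
  the agent at \<open>A\<close> costs at least as much as the one at \<open>p\<close>.\<close>

lemma left_agent_bound:
  assumes ob: "0 < ob" "ob < 1" and A: "0 \<le> A" "A < ob" and y: "ob < y" "y \<le> 1"
    and ab: "a = min A (ob - ob * c)" "b = max y (ob + c - ob * c)"
    and p: "0 \<le> p" "p \<le> A" and z: "0 \<le> z"
    and zA: "\<bar>A - a'\<bar> + k * (b' - a') + (1 - b') \<le> z"
    and zp: "\<bar>p - a'\<bar> + k * (b' - a') + (1 - b') \<le> z"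
    and zy: "\<bar>y - b'\<bar> + k * (b' - a') + a' \<le> z"
  shows "\<bar>p - a\<bar> + k * (b - a) + (1 - b) \<le> R * z"
proof -
  have nonneg: "0 \<le> ob * (1 - c)" "0 \<le> (1 - ob) * (1 - c)" using ob c_le_1 by auto
  have ab01: "0 \<le> a" "b \<le> 1"
    using nonneg A y unfolding ab by (auto simp: algebra_simps)
  show ?thesis
  proof (cases "p \<le> a")
    case True
    have "a - p + k * (b - a) + (1 - b) \<le> R * z"
      by (rule far_agent_bound[OF p(1) _ _ ab01 _ _ three_agent_lower_bound[OF k0 k1 zA zp zy] z])
        (use ab ab01 in auto)
    then show ?thesis using True by simp
  next
    case False
    then have a: "a = ob - ob * c" using p unfolding ab by auto
    have "A - a + k * (b - a) + (1 - b) \<le> R * z"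
    proof (rule obstacle_agent_bound[OF ob _ _ a ab(2)])
      show "k * (y - A) + (1 - k) / 2 * (1 - y) + (1 + k) / 2 * A \<le> z"
        using two_agent_lower_bound[OF k0 k1 _ _ zA zy, of "(1 - k) / 2"] k0 by (simp add: field_simps)
      show "k * (y - A) + (1 + k) / 2 * (1 - y) + (1 - k) / 2 * A \<le> z"
        using two_agent_lower_bound[OF k0 k1 _ _ zA zy, of "(1 + k) / 2"] k0 by (simp add: field_simps)
    qed (use A y in auto)
    then show ?thesis using False p by linarith
  qed
qed

end

section \<open>The mechanism TwoExtremeRestrict\<close>

lemma profile_extremesE:
  assumes "profile ob n x"
  obtains i j where
    "i \<in> left_agents ob n x" "Max (x ` left_agents ob n x) = x i"
    "\<And>s. s \<in> left_agents ob n x \<Longrightarrow> x s \<le> x i"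
    "j \<in> right_agents ob n x" "Min (x ` right_agents ob n x) = x j"
    "\<And>s. s \<in> right_agents ob n x \<Longrightarrow> x j \<le> x s"
proof -
  let ?A = "x ` left_agents ob n x" and ?B = "x ` right_agents ob n x"
  have fin: "finite ?A" "finite ?B" unfolding left_agents_def right_agents_def by auto
  have ne: "?A \<noteq> {}" "?B \<noteq> {}" using assms unfolding profile_def by auto
  obtain i where "i \<in> left_agents ob n x" "Max ?A = x i" using Max_in[OF fin(1) ne(1)] by auto
  moreover obtain j where "j \<in> right_agents ob n x" "Min ?B = x j"
    using Min_in[OF fin(2) ne(2)] by auto
  ultimately show thesis using that Max_ge[OF fin(1)] Min_le[OF fin(2)] by (metis imageI)
qed

lemma profile_agent_cases:
  assumes "profile ob n x" "s \<in> {1..n}"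
  shows "s \<in> left_agents ob n x \<and> 0 \<le> x s \<and> x s < ob \<or>
         s \<in> right_agents ob n x \<and> ob < x s \<and> x s \<le> 1"
  using assms unfolding profile_def left_agents_def right_agents_def by auto

lemma cost_left: "z < ob \<Longrightarrow> cost k ob (a, b) z = \<bar>z - a\<bar> + k * (b - a) + (1 - b)"
  and cost_right: "ob < z \<Longrightarrow> cost k ob (a, b) z = \<bar>z - b\<bar> + k * (b - a) + a"
  unfolding cost_def by auto

lemma mechanism_two_extreme_restrict:
  assumes c: "0 \<le> c" "c \<le> 1"
  shows "mechanism (two_extreme_restrict c)"
  unfolding mechanism_def
proof (intro allI impI, elim conjE)
  fix ob :: real and n and x :: "nat \<Rightarrow> real"
  assume ob: "0 < ob" "ob < 1" and P: "profile ob n x"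
  obtain i j where i: "i \<in> left_agents ob n x" "Max (x ` left_agents ob n x) = x i"
    and j: "j \<in> right_agents ob n x" "Min (x ` right_agents ob n x) = x j"
    using profile_extremesE[OF P] by metis
  have ij: "0 \<le> x i" "x i < ob" "ob < x j" "x j \<le> 1"
    using profile_agent_cases[OF P, of i] profile_agent_cases[OF P, of j] i(1) j(1)
    unfolding left_agents_def right_agents_def by auto
  have "0 \<le> ob * (1 - c)" "0 \<le> (1 - ob) * (1 - c)" using ob c by auto
  then show "two_extreme_restrict c ob n x \<in> edges ob"
    unfolding two_extreme_restrict_def edges_def i j using ij by (auto simp: algebra_simps)
qed

text \<open>An endpoint that moves away from the obstacle needs a strictly larger outward move of
  the other one, so neither does. An endpoint that moves towards the obstacle hurts a liar on its
  outer side. Hence the edge is unchanged and nobody gains.\<close>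

lemma group_strategyproof_two_extreme_restrict:
  assumes k: "0 \<le> k" "k < 1"
  shows "group_strategyproof k (two_extreme_restrict c)"
  unfolding group_strategyproof_def
proof (intro allI impI, elim conjE)
  fix ob :: real and n S and x x' :: "nat \<Rightarrow> real"
  assume ob: "0 < ob" "ob < 1" and P: "profile ob n x"
    and S: "S \<subseteq> {1..n}" "S \<noteq> {}" and mis: "misreport ob S x x'"
  define w where "w = override_on x x' S"
  have w_other: "w s = x s" if "s \<notin> S" for s using that unfolding w_def by simp
  have w_region: "(w s \<in> {0..<ob} \<longleftrightarrow> x s < ob) \<and> (w s \<in> {ob<..1} \<longleftrightarrow> x s > ob)"
    if "s \<in> {1..n}" for s
  proof (cases "s \<in> S")
    case True
    then show ?thesis
      using profile_agent_cases[OF P that] mis unfolding misreport_def w_def by fastforce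
  next
    case False
    then show ?thesis using profile_agent_cases[OF P that] w_other by auto
  qed
  have w_cases: "w s \<in> {0..<ob} \<union> {ob<..1}" if "s \<in> {1..n}" for s
    using w_region[OF that] profile_agent_cases[OF P that] by auto
  have same: "left_agents ob n w = left_agents ob n x" "right_agents ob n w = right_agents ob n x"
    unfolding left_agents_def right_agents_def using w_region w_cases by force+
  have Pw: "profile ob n w" using P w_cases same unfolding profile_def by simp
  obtain i j where i: "i \<in> left_agents ob n x" "Max (x ` left_agents ob n x) = x i"
      "\<And>s. s \<in> left_agents ob n x \<Longrightarrow> x s \<le> x i"
    and j: "j \<in> right_agents ob n x" "Min (x ` right_agents ob n x) = x j"
      "\<And>s. s \<in> right_agents ob n x \<Longrightarrow> x j \<le> x s"
    using profile_extremesE[OF P] by metis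
  obtain i' j' where i': "i' \<in> left_agents ob n x" "Max (w ` left_agents ob n x) = w i'"
      "\<And>s. s \<in> left_agents ob n x \<Longrightarrow> w s \<le> w i'"
    and j': "j' \<in> right_agents ob n x" "Min (w ` right_agents ob n x) = w j'"
      "\<And>s. s \<in> right_agents ob n x \<Longrightarrow> w j' \<le> w s"
    using profile_extremesE[OF Pw] unfolding same by metis
  define a0 b0 where "a0 = ob - ob * c" and "b0 = ob + c - ob * c"
  define a b a' b' where "a = min (x i) a0" and "b = max (x j) b0"
    and "a' = min (w i') a0" and "b' = max (w j') b0"
  have f: "two_extreme_restrict c ob n x = (a, b)" "two_extreme_restrict c ob n w = (a', b')"
    unfolding two_extreme_restrict_def same i(2) j(2) i'(2) j'(2) a_def b_def a'_def b'_def
      a0_def b0_def by simp_all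
  show "\<exists>s\<in>S. cost k ob (two_extreme_restrict c ob n x) (x s)
           \<le> cost k ob (two_extreme_restrict c ob n (override_on x x' S)) (x s)"
  proof (rule ccontr)
    assume "\<not> ?thesis"
    then have gain: "cost k ob (a', b') (x s) < cost k ob (a, b) (x s)" if "s \<in> S" for s
      using that unfolding w_def[symmetric] f by force
    have gain_left: "\<bar>x s - a'\<bar> + k * (b' - a') + (1 - b') < \<bar>x s - a\<bar> + k * (b - a) + (1 - b)"
      if "s \<in> S" "s \<in> left_agents ob n x" for s
      using gain[OF that(1)] that(2) unfolding left_agents_def by (simp add: cost_left)
    have gain_right: "\<bar>x s - b'\<bar> + k * (b' - a') + a' < \<bar>x s - b\<bar> + k * (b - a) + a"
      if "s \<in> S" "s \<in> right_agents ob n x" for s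
      using gain[OF that(1)] that(2) unfolding right_agents_def by (simp add: cost_right)
    \<comment> \<open>A larger \<open>b'\<close> means that every right report exceeds
      \<open>x j\<close>, so agent \<open>j\<close> itself has lied.\<close>
    have b_up: "(1 + k) * (b' - b) < (1 - k) * (a - a')" if "b < b'"
    proof -
      have "j \<in> S" using that j'(3)[OF j(1)] w_other[of j] unfolding b_def b'_def by fastforce
      from gain_right[OF this j(1)] that show ?thesis
        unfolding b_def by (simp add: algebra_simps abs_if split: if_splits)
    qed
    have a_down: "(1 + k) * (a - a') < (1 - k) * (b' - b)" if "a' < a"
    proof -
      have "i \<in> S" using that i'(3)[OF i(1)] w_other[of i] unfolding a_def a'_def by fastforce
      from gain_left[OF this i(1)] that show ?thesis
        unfolding a_def by (simp add: algebra_simps abs_if split: if_splits)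
    qed
    have contract: "(1 - k) * t \<le> (1 + k) * t" if "0 \<le> t" for t :: real
      using that k by (intro mult_right_mono) auto
    have pos: "0 < (1 - k) * t \<longleftrightarrow> 0 < t" for t :: real using k by (simp add: zero_less_mult_iff)
    have b'_le: "b' \<le> b"
    proof (rule ccontr)
      assume "\<not> b' \<le> b"
      then have b: "b < b'" by simp
      have "a' < a" using b_up[OF b] contract[of "b' - b"] pos[of "b' - b"] pos[of "a - a'"] b by linarith
      then show False
        using b_up[OF b] a_down contract[of "b' - b"] contract[of "a - a'"] b by linarith
    qed
    have a_le: "a \<le> a'"
    proof (rule ccontr)
      assume "\<not> a \<le> a'"
      then have a: "a' < a" by simp
      then show False
        using a_down[OF a] contract[of "a - a'"] pos[of "a - a'"] pos[of "b' - b"] b'_le by linarith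
    qed
    have "a' \<le> a"
    proof (rule ccontr)
      assume "\<not> a' \<le> a"
      then have a: "a < a'" by simp
      \<comment> \<open>As \<open>a' \<le> a0\<close>, the increase means \<open>a = x i\<close>;
        the new maximum \<open>w i'\<close> exceeds it, so \<open>i'\<close> has lied.\<close>
      then have "i' \<in> S" "x i' \<le> a"
        using i(3)[OF i'(1)] w_other[of i'] unfolding a_def a'_def by fastforce+
      then have "(1 - k) * ((a' - a) + (b - b')) < 0"
        using gain_left[OF _ i'(1)] a by (simp add: algebra_simps abs_if split: if_splits)
      then show False using pos[of "(a' - a) + (b - b')"] a b'_le by linarith
    qed
    have "b \<le> b'"
    proof (rule ccontr)
      assume "\<not> b \<le> b'"
      then have b: "b' < b" by simp
      then have "j' \<in> S" "b \<le> x j'"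
        using j(3)[OF j'(1)] w_other[of j'] unfolding b_def b'_def by fastforce+
      then have "(1 - k) * ((a' - a) + (b - b')) < 0"
        using gain_right[OF _ j'(1)] b by (simp add: algebra_simps abs_if split: if_splits)
      then show False using pos[of "(a' - a) + (b - b')"] b a_le by linarith
    qed
    with a_le b'_le \<open>a' \<le> a\<close> have "a' = a" "b' = b" by simp_all
    then show False using gain S by auto
  qed
qed

section \<open>From the real inequalities to the maximum cost\<close>

lemma max_cost_nonneg:
  assumes "0 \<le> k" "profile ob n x" "e \<in> edges ob"
  shows "0 \<le> max_cost k ob n e x"
proof -
  obtain a b where e: "e = (a, b)" by (cases e)
  have ab: "0 \<le> a" "a < ob" "ob < b" "b \<le> 1" using assms(3) unfolding e edges_def by auto
  then have "0 \<le> k * (b - a)" using assms(1) by simp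
  then have "0 \<le> cost k ob e z" for z using ab unfolding e cost_def by auto
  moreover obtain i where "i \<in> {1..n}" using assms(2) unfolding profile_def left_agents_def by blast
  ultimately show ?thesis unfolding max_cost_def by (subst Max_ge_iff) auto
qed

lemma (in ratio_constants) max_cost_two_extreme_restrict:
  assumes ob: "0 < ob" "ob < 1" and P: "profile ob n x" and e: "e \<in> edges ob"
  shows "max_cost k ob n (two_extreme_restrict c ob n x) x \<le> R * max_cost k ob n e x"
proof -
  obtain a' b' where e': "e = (a', b')" by (cases e)
  obtain i j where i: "i \<in> left_agents ob n x" "Max (x ` left_agents ob n x) = x i"
      "\<And>s. s \<in> left_agents ob n x \<Longrightarrow> x s \<le> x i"
    and j: "j \<in> right_agents ob n x" "Min (x ` right_agents ob n x) = x j"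
      "\<And>s. s \<in> right_agents ob n x \<Longrightarrow> x j \<le> x s"
    using profile_extremesE[OF P] by metis
  have ij: "i \<in> {1..n}" "j \<in> {1..n}" "0 \<le> x i" "x i < ob" "ob < x j" "x j \<le> 1"
    using profile_agent_cases[OF P, of i] profile_agent_cases[OF P, of j] i(1) j(1)
    unfolding left_agents_def right_agents_def by auto
  define a b where "a = min (x i) (ob - ob * c)" and "b = max (x j) (ob + c - ob * c)"
  have f: "two_extreme_restrict c ob n x = (a, b)"
    unfolding two_extreme_restrict_def i(2) j(2) a_def b_def by simp
  define z where "z = max_cost k ob n e x"
  have z: "cost k ob (a', b') (x s) \<le> z" if "s \<in> {1..n}" for s
    unfolding z_def max_cost_def e' using that by (intro Max_ge) auto
  have z_i: "\<bar>x i - a'\<bar> + k * (b' - a') + (1 - b') \<le> z"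
    using z[OF ij(1)] ij by (simp add: cost_left)
  have z_j: "\<bar>x j - b'\<bar> + k * (b' - a') + a' \<le> z"
    using z[OF ij(2)] ij by (simp add: cost_right)
  have z0: "0 \<le> z" unfolding z_def by (rule max_cost_nonneg[OF k0 P e])
  have "cost k ob (a, b) (x s) \<le> R * z" if s: "s \<in> {1..n}" for s
    using profile_agent_cases[OF P s]
  proof (elim disjE conjE)
    assume L: "s \<in> left_agents ob n x" "0 \<le> x s" "x s < ob"
    have "\<bar>x s - a\<bar> + k * (b - a) + (1 - b) \<le> R * z"
      by (rule left_agent_bound[OF ob ij(3-6) a_def b_def L(2) i(3)[OF L(1)] z0 z_i _ z_j])
        (use z[OF s] L in \<open>simp add: cost_left\<close>)
    then show ?thesis using L by (simp add: cost_left)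
  next
    assume L: "s \<in> right_agents ob n x" "ob < x s" "x s \<le> 1"
    \<comment> \<open>the reflection \<open>t \<mapsto> 1 - t\<close> exchanges the two regions\<close>
    have "\<bar>(1 - x s) - (1 - b)\<bar> + k * ((1 - a) - (1 - b)) + (1 - (1 - a)) \<le> R * z"
    proof (rule left_agent_bound[where ob = "1 - ob" and A = "1 - x j" and y = "1 - x i"
            and a' = "1 - b'" and b' = "1 - a'"])
      show "\<bar>1 - x s - (1 - b')\<bar> + k * (1 - a' - (1 - b')) + (1 - (1 - a')) \<le> z"
        using z[OF s] L by (simp add: cost_right abs_minus_commute)
      show "1 - x s \<le> 1 - x j" using j(3)[OF L(1)] by simp
      show "1 - b = min (1 - x j) (1 - ob - (1 - ob) * c)" "1 - a = max (1 - x i) (1 - ob + c - (1 - ob) * c)"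
        unfolding a_def b_def by (auto simp: algebra_simps min_def max_def)
    qed (use ob ij L z0 z_i z_j in \<open>simp_all add: abs_minus_commute\<close>)
    then show ?thesis using L by (simp add: cost_right abs_minus_commute)
  qed
  then show ?thesis
    unfolding f max_cost_def[of k ob n "(a, b)"] z_def[symmetric] using ij by (subst Max_le_iff) auto
qed

lemma (in ratio_constants) approx_ratio_two_extreme_restrict:
  assumes "R \<le> \<rho>"
  shows "approx_ratio_le k (two_extreme_restrict c) \<rho>"
  unfolding approx_ratio_le_def
proof (intro allI impI, elim conjE)
  fix ob :: real and n and x :: "nat \<Rightarrow> real"
  assume ob: "0 < ob" "ob < 1" and P: "profile ob n x"
  let ?f = "two_extreme_restrict c ob n x"
  have f: "?f \<in> edges ob"
    using mechanism_two_extreme_restrict[OF c0 c_le_1] ob P unfolding mechanism_def by blast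
  \<comment> \<open>Division by \<open>R\<close> turns the comparison with each edge into a lower
    bound on all values under the infimum.\<close>
  have "max_cost k ob n ?f x / R \<le> opt_max_cost k ob n x"
    unfolding opt_max_cost_def
    using f max_cost_two_extreme_restrict[OF ob P] R_pos
    by (intro cINF_greatest) (auto simp: field_simps)
  then have opt: "max_cost k ob n ?f x \<le> R * opt_max_cost k ob n x"
    using R_pos by (simp add: field_simps)
  have "0 \<le> opt_max_cost k ob n x"
    unfolding opt_max_cost_def using f max_cost_nonneg[OF k0 P] by (intro cINF_greatest) auto
  then show "max_cost k ob n ?f x \<le> \<rho> * opt_max_cost k ob n x"
    using opt mult_right_mono[OF assms] by fastforce
qed

section \<open>The parameter of the mechanism\<close>

text \<open>With \<open>D\<close> the radicand, clearing the positive denominators turns the two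
  bounds into \<open>k + k^2 \<le> sqrt D\<close> and \<open>sqrt D \<le> 1 + k^2\<close>. The
  differences of the squares factor into nonnegative terms.\<close>

lemma c_param_bounds:
  assumes "0 \<le> k" "k < 1"
  shows "0 \<le> c_param k" "c_param k * (1 + k) \<le> 1"
proof -
  define D where "D = k ^ 4 - k ^ 3 + 3 * k\<^sup>2 + k"
  have pos: "0 < 1 - k\<^sup>2" "0 < 1 - k" using assms by (auto simp: power_less_one_iff abs_square_less_1)
  have "0 \<le> (1 - k)\<^sup>2 * (1 + k)" using assms by simp
  also have "(1 - k)\<^sup>2 * (1 + k) = (1 + k\<^sup>2)\<^sup>2 - D"
    unfolding D_def by (simp add: power2_eq_square power3_eq_cube power4_eq_xxxx algebra_simps)
  finally have "sqrt D \<le> 1 + k\<^sup>2" by (intro real_le_lsqrt) auto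
  then show "0 \<le> c_param k" unfolding c_param_def D_def using pos by simp
  have "0 \<le> k * (1 - k) * (1 + 3 * k)" using assms by simp
  also have "k * (1 - k) * (1 + 3 * k) = D - (k + k\<^sup>2)\<^sup>2"
    unfolding D_def by (simp add: power2_eq_square power3_eq_cube power4_eq_xxxx algebra_simps)
  finally have "k + k\<^sup>2 \<le> sqrt D" by (intro real_le_rsqrt) auto
  then have "(1 + k\<^sup>2 - sqrt D) / (1 - k) \<le> 1" using pos by simp
  moreover have "c_param k * (1 + k) = (1 + k\<^sup>2 - sqrt D) / (1 - k)"
  proof -
    have "1 - k\<^sup>2 = (1 - k) * (1 + k)" by (simp add: power2_eq_square algebra_simps)
    then show ?thesis unfolding c_param_def D_def using assms pos by simp
  qed
  ultimately show "c_param k * (1 + k) \<le> 1" by simp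
qed

text \<open>
  At \<open>k = 0\<close> the term \<open>c = 1\<close> alone gives the ratio \<open>2\<close>, and the first two constraints
  degenerate to \<open>0 \<le> 0\<close>, so the limits of the first two quotients need not be computed.
\<close>

lemma ratio_constants_c_param:
  assumes k: "0 \<le> k" "k < 1"
  shows "ratio_constants k (c_param k) (min 2 (ratio_bound k))"
proof -
  define c where "c = c_param k"
  define m where "m = 1 - (1 - k) * c"
  have c: "0 \<le> c" "c * (1 + k) \<le> 1" using c_param_bounds[OF k] unfolding c_def by auto
  have ck: "0 \<le> c * k" using c k by simp
  have c1: "c \<le> 1" using c ck by (simp add: distrib_left)
  have m0: "0 \<le> m" using c1 ck unfolding m_def by (simp add: algebra_simps)
  let ?B = "{limit_at_zero quotient1 k, limit_at_zero quotient2 k, quotient3 k, c_param k}"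
  have B: "2 * q \<le> ratio_bound k" if "q \<in> ?B" for q
    unfolding ratio_bound_def using Max_ge[of ?B q] that by simp
  have Bc: "2 * c \<le> ratio_bound k" using B[of "c_param k"] unfolding c_def by simp
  \<comment> \<open>The denominator of the third quotient lies in \<open>(0, 2]\<close>, so twice
    the quotient is at least its numerator.\<close>
  have "1 + 2 * k * c \<le> 2 * quotient3 k"
  proof -
    have "0 \<le> (1 - k) * c" "(1 - k) * c < 2" using m0 c k unfolding m_def by auto
    then have "(1 + 2 * k * c) / 2 \<le> (1 + 2 * c * k) / (2 - (1 - k) * c)"
      using ck by (intro frac_le) (auto simp: mult.commute mult.left_commute)
    then show ?thesis unfolding quotient3_def Let_def c_def[symmetric] by simp
  qed
  then have B3: "1 + 2 * k * c \<le> ratio_bound k" using B[of "quotient3 k"] by simp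
  have B12: "2 * m \<le> ratio_bound k * (m + k)"
    "k * (2 * c - c\<^sup>2) + 1 - c\<^sup>2 \<le> ratio_bound k * m"
  proof -
    have "2 * m \<le> ratio_bound k * (m + k) \<and> k * (2 * c - c\<^sup>2) + 1 - c\<^sup>2 \<le> ratio_bound k * m"
    proof (cases "k = 0")
      case True
      then have "c = 1" unfolding c_def c_param_def by simp
      then show ?thesis using True unfolding m_def by simp
    next
      case False
      then have k0: "0 < k" using k by simp
      have m_pos: "0 < m"
      proof (cases "c = 0")
        case False
        then have "0 < c * k" using c k0 by simp
        then show ?thesis unfolding m_def using c1 by (simp add: algebra_simps)
      qed (simp add: m_def)
      have "2 * (m / (m + k)) \<le> ratio_bound k"
        using B[of "quotient1 k"] False
        unfolding limit_at_zero_def quotient1_def Let_def c_def[symmetric] m_def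
        by (simp add: algebra_simps)
      moreover have "2 * ((k * (2 * c - c\<^sup>2) + 1 - c\<^sup>2) / (2 * m)) \<le> ratio_bound k"
        using B[of "quotient2 k"] False
        unfolding limit_at_zero_def quotient2_def Let_def c_def[symmetric] m_def
        by (simp add: algebra_simps)
      ultimately show ?thesis using m_pos k0 by (simp add: pos_divide_le_eq)
    qed
    then show "2 * m \<le> ratio_bound k * (m + k)"
      "k * (2 * c - c\<^sup>2) + 1 - c\<^sup>2 \<le> ratio_bound k * m" by auto
  qed
  \<comment> \<open>The constraints also hold for the ratio 2, so they survive taking the minimum
    with 2.\<close>
  have T1: "2 * m \<le> 2 * (m + k)" using k by simp
  have T2: "k * (2 * c - c\<^sup>2) + 1 - c\<^sup>2 \<le> 2 * m"
  proof -
    have "0 \<le> (1 - c)\<^sup>2 + k * c\<^sup>2" using k by simp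
    then show ?thesis unfolding m_def by (simp add: power2_eq_square algebra_simps)
  qed
  have T3: "1 + 2 * k * c \<le> 2"
  proof -
    have "k * c \<le> c" using k c by (simp add: mult_left_le_one_le)
    then show ?thesis using c by (simp add: algebra_simps)
  qed
  show ?thesis
    unfolding c_def[symmetric]
    using k c c1 Bc B3 B12 T1 T2 T3 unfolding m_def
    by unfold_locales (auto simp: min_def algebra_simps)
qed

theorem theorem6:
  fixes k :: real
  assumes "0 \<le> k" and "k < 1"
  shows "c_param k \<in> {0..1} \<and>
    mechanism (two_extreme_restrict (c_param k)) \<and>
    group_strategyproof k (two_extreme_restrict (c_param k)) \<and>
    approx_ratio_le k (two_extreme_restrict (c_param k)) (ratio_bound k)"
proof -
  interpret ratio_constants k "c_param k" "min 2 (ratio_bound k)"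
    by (rule ratio_constants_c_param[OF assms])
  show ?thesis
    using c0 c_le_1 mechanism_two_extreme_restrict[OF c0 c_le_1]
      group_strategyproof_two_extreme_restrict[OF assms] approx_ratio_two_extreme_restrict
    by simp
qed

end
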